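(* Let $\mathcal{H}$ be a complex Hilbert space, $A\in\mathbb{B}(\mathcal{H})$ a nonzero positive operator, $\lambda\in[0,1]$, and $T,S\in\mathbb{B}_{A^{1/2}}(\mathcal{H})$. The following statements are equivalent. (i) For each $\theta\in[0,2\pi)$ there exists a sequence $\{x_n\}$ of $A$-unit vectors in $\mathcal{H}$ such that the following two conditions hold: $$\lim_{n\to\infty}\Big(\lambda\|Tx_n\|_A^2+(1-\lambda)|\langle Tx_n,x_n\rangle_A|^2\Big)=\|T\|_{(A,\lambda)}^2,$$ $$\lim_{n\to\infty}\mathrm{Re}\Big(e^{i\theta}\lambda\langle Sx_n,Tx_n\rangle_A+e^{i\theta}(1-\lambda)\langle x_n,Tx_n\rangle_A\,\langle Sx_n,x_n\rangle_A\Big)\ge 0.$$ (ii) For all $\xi\in\mathbb{C}$, $\ \|T+\xi S\|_{(A,\lambda)}^2\ge\|T\|_{(A,\lambda)}^2+|\xi|^2\,m_{(A,\lambda)}^2(S)$, where $$m_{(A,\lambda)}(S)=\inf\Big\{\sqrt{\lambda\|Sx\|_A^2+(1-\lambda)|\langle Sx,x\rangle_A|^2}:\ x\in\mathcal{H},\ \|x\|_A=1\Big\}.$$ (iii) $T\perp_{(A,\lambda)}S$, that is, $\|T+\xi S\|_{(A,\lambda)}\ge\|T\|_{(A,\lambda)}$ for all $\xi\in\mathbb{C}$.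
   Context: $\mathbb{B}(\mathcal{H})$ is the algebra of all bounded linear operators on the complex Hilbert space $(\mathcal{H},\langle\cdot,\cdot\rangle)$, with inner product linear in the first argument. The positive (semidefinite) operator $A\in\mathbb{B}(\mathcal{H})$ induces the positive semidefinite sesquilinear form $\langle x,y\rangle_A=\langle Ax,y\rangle$ and the seminorm $\|x\|_A=\sqrt{\langle x,x\rangle_A}$ on $\mathcal{H}$; $A$ is nonzero, so that vectors with $\|x\|_A=1$ exist. An $A$-unit vector is an $x\in\mathcal{H}$ with $\|x\|_A=1$. For a positive operator $B$, an operator $R\in\mathbb{B}(\mathcal{H})$ is a $B$-adjoint of $T\in\mathbb{B}(\mathcal{H})$ if $\langle BTx,y\rangle=\langle Bx,Ry\rangle$ for all $x,y\in\mathcal{H}$. $\mathbb{B}_{A^{1/2}}(\mathcal{H})$ is the set of all $T\in\mathbb{B}(\mathcal{H})$ admitting an $A^{1/2}$-adjoint, where $A^{1/2}$ is the positive square root of $A$. For $T\in\mathbb{B}_{A^{1/2}}(\mathcal{H})$ one has $\sup\{\|Tx\|_A:\|x\|_A=1\}<+\infty$, and $$\|T\|_{(A,\lambda)}=\sup\Big\{\sqrt{\lambda\|Tx\|_A^2+(1-\lambda)|\langle Tx,x\rangle_A|^2}:\ x\in\mathcal{H},\ \|x\|_A=1\Big\}.$$ In (i), the second condition asserts that the limit exists and is nonnegative. *)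

theory Defs
  imports "HOL-Analysis.Analysis"
begin

(* The distribution has no complex inner product spaces, so they are introduced here on top of
   the real normed spaces. The inner product is linear in the first argument and conjugate-linear
   in the second. Its definiteness is implied by cinner_norm and the norm axioms. *)

class complex_inner = real_normed_vector +
  fixes scaleC :: "complex \<Rightarrow> 'a \<Rightarrow> 'a"  (infixr \<open>*\<^sub>C\<close> 75)
    and cinner :: "'a \<Rightarrow> 'a \<Rightarrow> complex"
  assumes scaleC_add_right: "a *\<^sub>C (x + y) = a *\<^sub>C x + a *\<^sub>C y"
    and scaleC_add_left: "(a + b) *\<^sub>C x = a *\<^sub>C x + b *\<^sub>C x"
    and scaleC_scaleC: "a *\<^sub>C b *\<^sub>C x = (a * b) *\<^sub>C x"
    and scaleC_one: "1 *\<^sub>C x = x"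
    and scaleR_scaleC: "r *\<^sub>R x = complex_of_real r *\<^sub>C x"
    and cinner_commute: "cinner x y = cnj (cinner y x)"
    and cinner_add_left: "cinner (x + y) z = cinner x z + cinner y z"
    and cinner_scaleC_left: "cinner (a *\<^sub>C x) y = a * cinner x y"
    and cinner_norm: "norm x = sqrt (Re (cinner x x))"

class complex_hilbert = complex_inner + complete_space

instantiation complex :: complex_hilbert
begin

definition scaleC_complex :: "complex \<Rightarrow> complex \<Rightarrow> complex"
  where "scaleC_complex a x = a * x"

definition cinner_complex :: "complex \<Rightarrow> complex \<Rightarrow> complex"
  where "cinner_complex x y = x * cnj y"

instance
proof
  show "norm x = sqrt (Re (cinner x x))" for x :: complex
    by (simp add: cinner_complex_def cmod_def power2_eq_square)
qed (auto simp: scaleC_complex_def cinner_complex_def algebra_simps scaleR_conv_of_real)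

end

definition bounded_op :: "('a::complex_hilbert \<Rightarrow> 'a) \<Rightarrow> bool"
  where "bounded_op T \<longleftrightarrow> bounded_linear T \<and> (\<forall>c x. T (c *\<^sub>C x) = c *\<^sub>C T x)"

definition positive_op :: "('a::complex_hilbert \<Rightarrow> 'a) \<Rightarrow> bool"
  where "positive_op A \<longleftrightarrow> bounded_op A \<and> (\<forall>x. cinner (A x) x \<in> \<real>\<^sub>\<ge>\<^sub>0)"

(* Meaningful for positive A only, which has exactly one positive square root. *)
definition op_sqrt :: "('a::complex_hilbert \<Rightarrow> 'a) \<Rightarrow> 'a \<Rightarrow> 'a"
  where "op_sqrt A = (THE B. positive_op B \<and> B \<circ> B = A)"

definition is_adjoint_wrt ::
    "('a::complex_hilbert \<Rightarrow> 'a) \<Rightarrow> ('a \<Rightarrow> 'a) \<Rightarrow> ('a \<Rightarrow> 'a) \<Rightarrow> bool"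
  where "is_adjoint_wrt B T R \<longleftrightarrow>
    bounded_op R \<and> (\<forall>x y. cinner (B (T x)) y = cinner (B x) (R y))"

definition adjointable_ops :: "('a::complex_hilbert \<Rightarrow> 'a) \<Rightarrow> ('a \<Rightarrow> 'a) set"
  where "adjointable_ops B = {T. bounded_op T \<and> (\<exists>R. is_adjoint_wrt B T R)}"

definition inner_wrt :: "('a::complex_hilbert \<Rightarrow> 'a) \<Rightarrow> 'a \<Rightarrow> 'a \<Rightarrow> complex"
  where "inner_wrt A x y = cinner (A x) y"

definition norm_wrt :: "('a::complex_hilbert \<Rightarrow> 'a) \<Rightarrow> 'a \<Rightarrow> real"
  where "norm_wrt A x = sqrt (Re (inner_wrt A x x))"

definition unit_vecs :: "('a::complex_hilbert \<Rightarrow> 'a) \<Rightarrow> 'a set"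
  where "unit_vecs A = {x. norm_wrt A x = 1}"

(* Real-valued Sup and Inf. For nonzero positive A the index set is nonempty, and for l in [0,1]
   and T in adjointable_ops (op_sqrt A) the values are bounded. *)
definition op_norm :: "('a::complex_hilbert \<Rightarrow> 'a) \<Rightarrow> real \<Rightarrow> ('a \<Rightarrow> 'a) \<Rightarrow> real"
  where "op_norm A l T =
    (SUP x\<in>unit_vecs A. sqrt (l * (norm_wrt A (T x))\<^sup>2 + (1 - l) * (cmod (inner_wrt A (T x) x))\<^sup>2))"

definition op_minmod :: "('a::complex_hilbert \<Rightarrow> 'a) \<Rightarrow> real \<Rightarrow> ('a \<Rightarrow> 'a) \<Rightarrow> real"
  where "op_minmod A l S =
    (INF x\<in>unit_vecs A. sqrt (l * (norm_wrt A (S x))\<^sup>2 + (1 - l) * (cmod (inner_wrt A (S x) x))\<^sup>2))"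

definition op_orthogonal ::
    "('a::complex_hilbert \<Rightarrow> 'a) \<Rightarrow> real \<Rightarrow> ('a \<Rightarrow> 'a) \<Rightarrow> ('a \<Rightarrow> 'a) \<Rightarrow> bool"
  where "op_orthogonal A l T S \<longleftrightarrow> (\<forall>\<xi>. op_norm A l (\<lambda>x. T x + \<xi> *\<^sub>C S x) \<ge> op_norm A l T)"

end

theory Submission
  imports Defs
begin

text \<open>
  Write $f_T(x) = \lambda \|Tx\|_A^2 + (1-\lambda) |\langle Tx,x\rangle_A|^2$. For fixed $x$ this is
  the square of a Hilbert space seminorm of $T$, since
  $T \mapsto (\sqrt\lambda\, A^{1/2}Tx, \sqrt{1-\lambda}\,\langle Tx,x\rangle_A)$ is linear. Hence
  $f_{T+\xi S}(x) = f_T(x) + 2 \mathrm{Re}(\xi\, g(x)) + |\xi|^2 f_S(x)$, where $g(x)$ is the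
  sesquilinear cross term whose real part appears in (i); this is \<open>local_sq_add_scaleC\<close>.

  Given (i), insert the sequence belonging to the argument of $\xi$ into this identity and pass to
  the limit: the cross term contributes a nonnegative amount and $f_S \ge m^2$, which is (ii)
  (\<open>norming_seq_imp_ge\<close>). Statement (iii) follows from (ii) by dropping the last summand. Given
  (iii), let $\xi = r e^{i\theta}$ with $r \to 0$ and choose $x$ with
  $f_{T+\xi S}(x) > \|T\|^2 - r^2$. The identity reads
  $f_T(x) + 2r\, \mathrm{Re}(e^{i\theta} g(x)) \ge \|T\|^2 - O(r^2)$. As $g$ is bounded,
  $f_T(x) \to \|T\|^2$; as $f_T(x) \le \|T\|^2$, division by $r$ gives
  $\mathrm{Re}(e^{i\theta} g(x)) \ge -O(r)$. A subsequence along which this bounded real sequence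
  converges is as required (\<open>orthogonal_imp_norming_seq\<close>).

  All of this rests on the suprema being finite. If $R$ is an $A^{1/2}$-adjoint of $T$, then
  $\|A^{1/2}Tx\|^2 = \langle A^{1/2}x, R A^{1/2}Tx\rangle \le \|x\|_A \|R\| \|Tx\|_A$, so
  $\|Tx\|_A \le \|R\| \|x\|_A$ (\<open>adjointable_imp_bounded_wrt\<close>). The computation uses that
  $A^{1/2}$ really is a positive square root of $A$, that is, existence and uniqueness of the
  positive square root. Existence comes from the power series of $1 - \sqrt{1-t}$ at $t = Y$, where
  $A = k(1-Y)$ with $0 \le Y \le 1$; its coefficients are nonnegative with sum at most 1, so it
  converges absolutely and may be squared termwise (\<open>root_series_square\<close>). Uniqueness holds
  because the square root so constructed commutes with every bounded operator that
  commutes with $A$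
  (\<open>positive_op_ex1_sqrt\<close>).
\<close>

section \<open>Complex inner products and positive operators\<close>

subclass (in complex_hilbert) banach ..

lemma cinner_add_right: "cinner x (y + z) = cinner x y + cinner (x::'a::complex_inner) z"
  by (metis cinner_add_left cinner_commute complex_cnj_add)

lemma cinner_scaleC_right: "cinner x (a *\<^sub>C y) = cnj a * cinner (x::'a::complex_inner) y"
  by (metis cinner_commute cinner_scaleC_left complex_cnj_mult)

lemma cinner_scaleR_left: "cinner (r *\<^sub>R x) y = of_real r * cinner (x::'a::complex_inner) y"
  by (simp add: scaleR_scaleC cinner_scaleC_left)

lemma cinner_zero_left: "cinner 0 (y::'a::complex_inner) = 0"
  using cinner_scaleR_left[of 0 0 y] by simp

lemma cinner_minus_left: "cinner (- x) y = - cinner (x::'a::complex_inner) y"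
  using cinner_scaleR_left[of "-1" x y] by simp

lemma cinner_diff_left: "cinner (x - y) z = cinner x z - cinner (y::'a::complex_inner) z"
  using cinner_add_left[of x "-y" z] by (simp add: cinner_minus_left)

lemma cinner_self: "cinner x x = complex_of_real ((norm (x::'a::complex_inner))\<^sup>2)"
proof -
  have "Im (cinner x x) = 0"
    using arg_cong[OF cinner_commute[of x x], of Im] by simp
  moreover have "Re (cinner x x) \<ge> 0"
    using norm_ge_zero[of x] cinner_norm[of x] by simp
  ultimately show ?thesis
    by (simp add: complex_eq_iff cinner_norm)
qed

lemma bounded_op_add: "bounded_op A \<Longrightarrow> A (x + y) = A x + A y"
  by (simp add: bounded_op_def bounded_linear.linear linear_add)

lemma bounded_op_diff: "bounded_op A \<Longrightarrow> A (x - y) = A x - A y"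
  by (simp add: bounded_op_def bounded_linear.linear linear_diff)

lemma bounded_op_scaleR: "bounded_op A \<Longrightarrow> A (r *\<^sub>R x) = r *\<^sub>R A x"
  by (simp add: bounded_op_def bounded_linear.linear linear_scale)

lemma bounded_op_scaleC: "bounded_op A \<Longrightarrow> A (c *\<^sub>C x) = c *\<^sub>C A x"
  by (simp add: bounded_op_def)

text \<open>Polarization: over the complex numbers a real quadratic form has a Hermitian sesquilinear form,
  as one sees by comparing imaginary parts at $x + y$ and $x + iy$.\<close>

lemma positive_op_selfadjoint:
  assumes "positive_op A"
  shows "cinner (A x) y = cinner x (A y)"
proof -
  have A: "bounded_op A" and pos: "\<And>x. cinner (A x) x \<in> \<real>\<^sub>\<ge>\<^sub>0"
    using assms by (auto simp: positive_op_def)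
  have im: "Im (cinner (A z) z) = 0" for z
    using pos[of z] by (auto simp: complex_nonneg_Reals_iff)
  have "Im (cinner (A x) y + cinner (A y) x) = 0"
    using im[of "x + y"] im[of x] im[of y]
    by (simp add: bounded_op_add[OF A] cinner_add_left cinner_add_right)
  moreover have "Im (- \<i> * cinner (A x) y + \<i> * cinner (A y) x) = 0"
    using im[of "x + \<i> *\<^sub>C y"] im[of x] im[of y]
    by (simp add: bounded_op_add[OF A] bounded_op_scaleC[OF A] cinner_add_left cinner_add_right
        cinner_scaleC_left cinner_scaleC_right algebra_simps)
  ultimately have "cinner (A x) y = cnj (cinner (A y) x)"
    by (simp add: complex_eq_iff)
  then show ?thesis
    using cinner_commute[of x "A y"] by simp
qed

lemma positive_op_Re_nonneg: "positive_op A \<Longrightarrow> 0 \<le> Re (cinner (A x) x)"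
  by (auto simp: positive_op_def complex_nonneg_Reals_iff)

lemma positive_op_cinner_self: "positive_op A \<Longrightarrow> cinner (A x) x = of_real (Re (cinner (A x) x))"
  by (auto simp: positive_op_def complex_nonneg_Reals_iff complex_eq_iff)

text \<open>The usual discriminant argument: the form is nonnegative at $x - t\langle Ax,y\rangle y$ for all real
  $t$. The form may be degenerate, so the case $\langle Ay,y\rangle = 0$ is treated by letting $t$ grow.
  For $A = 1$ this is the Cauchy-Schwarz inequality of the inner product itself.\<close>

lemma Cauchy_Schwarz_positive_op:
  assumes "positive_op A"
  shows "(cmod (cinner (A x) y))\<^sup>2 \<le> Re (cinner (A x) x) * Re (cinner (A y) y)"
proof -
  have A: "bounded_op A"
    using assms by (auto simp: positive_op_def)
  define a b g where "a = Re (cinner (A x) x)" and "b = Re (cinner (A y) y)"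
    and "g = cinner (A x) y"
  have g': "cinner (A y) x = cnj g"
    by (metis assms cinner_commute g_def positive_op_selfadjoint)
  have quad: "0 \<le> a - 2 * t * (cmod g)\<^sup>2 + t\<^sup>2 * (cmod g)\<^sup>2 * b" for t :: real
  proof -
    define c where "c = - (of_real t * g)"
    have "cinner (A (x + c *\<^sub>C y)) (x + c *\<^sub>C y)
        = cinner (A x) x + cnj c * g + c * cnj g + c * cnj c * cinner (A y) y"
      by (simp add: bounded_op_add[OF A] bounded_op_scaleC[OF A] cinner_add_left cinner_add_right
        cinner_scaleC_left cinner_scaleC_right g' g_def[symmetric] algebra_simps)
    also have "\<dots> = of_real a - 2 * of_real t * (g * cnj g) + (of_real t)\<^sup>2 * (g * cnj g) * of_real b"
      using positive_op_cinner_self[OF assms, of x] positive_op_cinner_self[OF assms, of y]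
      by (simp add: a_def b_def c_def power2_eq_square algebra_simps)
    also have "\<dots> = of_real (a - 2 * t * (cmod g)\<^sup>2 + t\<^sup>2 * (cmod g)\<^sup>2 * b)"
      by (simp add: complex_norm_square[symmetric])
    finally show ?thesis
      using positive_op_Re_nonneg[OF assms, of "x + c *\<^sub>C y"] by simp
  qed
  have "a \<ge> 0" "b \<ge> 0"
    using positive_op_Re_nonneg[OF assms] by (auto simp: a_def b_def)
  show ?thesis
  proof (cases "b = 0")
    case True
    have "g = 0"
    proof (rule ccontr)
      assume "g \<noteq> 0"
      with quad[of "(a + 1) / (cmod g)\<^sup>2"] \<open>a \<ge> 0\<close> True show False
        by simp
    qed
    then show ?thesis
      using \<open>a \<ge> 0\<close> \<open>b \<ge> 0\<close> by (simp add: a_def b_def g_def)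
  next
    case False
    with quad[of "1 / b"] \<open>b \<ge> 0\<close> have "(cmod g)\<^sup>2 \<le> a * b"
      by (simp add: field_simps power2_eq_square)
    then show ?thesis
      by (simp add: a_def b_def g_def)
  qed
qed

lemma positive_op_id: "positive_op (\<lambda>x. x)"
  by (auto simp: positive_op_def bounded_op_def cinner_self bounded_linear_ident complex_nonneg_Reals_iff)

lemma cmod_cinner_le: "cmod (cinner x y) \<le> norm x * norm (y::'a::complex_hilbert)"
proof -
  have "(cmod (cinner x y))\<^sup>2 \<le> (norm x * norm y)\<^sup>2"
    using Cauchy_Schwarz_positive_op[OF positive_op_id, of x y]
    by (simp add: cinner_self power_mult_distrib flip: of_real_power)
  then show ?thesis
    by (rule power2_le_imp_le) simp
qed

lemma bounded_linear_cinner_left: "bounded_linear (\<lambda>x. cinner x (y::'a::complex_hilbert))"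
  by (rule bounded_linear_intro[where K = "norm y"])
    (simp_all add: cinner_add_left cinner_scaleR_left cmod_cinner_le scaleR_conv_of_real)

lemma norm_scaleC: "norm (c *\<^sub>C (x::'a::complex_inner)) = cmod c * norm x"
proof -
  have "cinner (c *\<^sub>C x) (c *\<^sub>C x) = (c * cnj c) * cinner x x"
    by (simp add: cinner_scaleC_left cinner_scaleC_right)
  also have "\<dots> = complex_of_real ((cmod c * norm x)\<^sup>2)"
    by (simp add: cinner_self complex_norm_square[symmetric] power_mult_distrib flip: of_real_power)
  finally show ?thesis
    by (simp add: cinner_norm[of "c *\<^sub>C x"] del: of_real_power)
qed

lemma bounded_linear_scaleC: "bounded_linear (\<lambda>x. c *\<^sub>C (x::'a::complex_inner))"
  by (rule bounded_linear_intro[where K = "cmod c"])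
    (simp_all add: scaleC_add_right norm_scaleC scaleR_scaleC scaleC_scaleC mult.commute)

lemma scaleC_diff_right: "c *\<^sub>C (x - y) = c *\<^sub>C x - c *\<^sub>C (y::'a::complex_inner)"
  by (rule linear_diff[OF bounded_linear.linear[OF bounded_linear_scaleC]])

lemma bounded_op_ident: "bounded_op (\<lambda>x. x)"
  by (simp add: bounded_op_def bounded_linear_ident)

lemma bounded_op_diff_op:
  "bounded_op A \<Longrightarrow> bounded_op B \<Longrightarrow> bounded_op (\<lambda>x. A x - B x)"
  by (simp add: bounded_op_def bounded_linear_sub scaleC_diff_right)

lemma bounded_op_scaleR_op: "bounded_op A \<Longrightarrow> bounded_op (\<lambda>x. r *\<^sub>R A x)"
  using bounded_linear_const_scaleR[of A r]
  by (auto simp: bounded_op_def) (simp add: scaleR_scaleC scaleC_scaleC mult.commute)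

section \<open>The power series of the square root\<close>

text \<open>The Taylor coefficients of $p(t) = 1 - \sqrt{1-t}$ at 0. The recursion is the functional equation
  $p^2 = 2p - t$ read coefficientwise; it makes their nonnegativity evident.\<close>

fun sqrt_coeff :: "nat \<Rightarrow> real" where
  "sqrt_coeff n = (if n = 1 then 1/2 else (\<Sum>i\<in>{1..<n}. sqrt_coeff i * sqrt_coeff (n - i)) / 2)"

declare sqrt_coeff.simps[simp del]

lemma sqrt_coeff_nonneg: "0 \<le> sqrt_coeff n"
  by (induction n rule: less_induct) (subst sqrt_coeff.simps, auto intro!: sum_nonneg)

lemma sqrt_coeff_0: "sqrt_coeff 0 = 0"
  by (subst sqrt_coeff.simps) simp

lemma sqrt_coeff_convolution:
  "(\<Sum>i\<le>n. sqrt_coeff i * sqrt_coeff (n - i)) = 2 * sqrt_coeff n - (if n = 1 then 1 else 0)"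
proof -
  have "(\<Sum>i\<le>n. sqrt_coeff i * sqrt_coeff (n - i)) = (\<Sum>i\<in>{1..<n}. sqrt_coeff i * sqrt_coeff (n - i))"
    by (rule sum.mono_neutral_right) (auto simp: sqrt_coeff_0 Suc_le_eq intro: ccontr)
  then show ?thesis
    by (subst (3) sqrt_coeff.simps) auto
qed

text \<open>The partial sums $s_n$ satisfy $2 s_{n+1} \le 1 + s_n^2$: the triangle of products summing to
  $2 s_{n+1} - 1$ lies in the square of products that makes up $s_n^2$, since $c_0 = 0$ forces both
  indices to be positive and therefore at most $n-1$. Induction keeps them below 1.\<close>

lemma sum_sqrt_coeff_le_1: "(\<Sum>i<n. sqrt_coeff i) \<le> 1"
proof (induction n)
  case (Suc n)
  let ?c = sqrt_coeff
  have "(\<Sum>k<Suc n. 2 * ?c k) = (\<Sum>k<Suc n. (if k = 1 then 1 else 0) + (\<Sum>i\<le>k. ?c i * ?c (k - i)))"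
    by (simp add: sqrt_coeff_convolution)
  also have "\<dots> \<le> 1 + (\<Sum>k<Suc n. \<Sum>i\<le>k. ?c i * ?c (k - i))"
    by (simp add: sum.distrib sum.delta del: sum.lessThan_Suc)
  also have "(\<Sum>k<Suc n. \<Sum>i\<le>k. ?c i * ?c (k - i)) = (\<Sum>(i, j)\<in>{(i, j). i + j < Suc n}. ?c i * ?c j)"
    by (rule sum.triangle_reindex[symmetric])
  also have "\<dots> = (\<Sum>(i, j)\<in>{(i, j). i + j < Suc n \<and> 0 < i \<and> 0 < j}. ?c i * ?c j)"
    by (rule sum.mono_neutral_right)
      (auto simp: sqrt_coeff_0 intro!: gr0I intro: finite_subset[of _ "{..n} \<times> {..n}"])
  also have "\<dots> \<le> (\<Sum>(i, j)\<in>{..<n} \<times> {..<n}. ?c i * ?c j)"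
    by (rule sum_mono2) (auto simp: sqrt_coeff_nonneg)
  also have "\<dots> = (\<Sum>i<n. ?c i)\<^sup>2"
    by (simp add: power2_eq_square sum_product sum.cartesian_product)
  also have "\<dots> \<le> 1"
    using Suc by (intro power_le_one) (auto intro: sum_nonneg sqrt_coeff_nonneg)
  finally show ?case
    by (simp add: sum_distrib_left[symmetric] del: sum.lessThan_Suc)
qed simp

lemma summable_sqrt_coeff: "summable sqrt_coeff"
  by (rule bounded_imp_summable[where B = 1])
    (auto simp: sqrt_coeff_nonneg lessThan_Suc_atMost[symmetric] sum_sqrt_coeff_le_1 simp del: sum.lessThan_Suc)

lemma suminf_sqrt_coeff_le_1: "(\<Sum>n. sqrt_coeff n) \<le> 1"
  by (rule suminf_le_const[OF summable_sqrt_coeff sum_sqrt_coeff_le_1])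


section \<open>The positive square root\<close>

lemma bounded_op_funpow: "bounded_op Y \<Longrightarrow> bounded_op (Y ^^ n)"
proof (induction n)
  case 0
  then show ?case by (simp add: bounded_op_def bounded_linear_ident id_def)
next
  case (Suc n)
  then show ?case
    using bounded_linear_compose[of Y "Y ^^ n"] by (simp add: bounded_op_def o_def)
qed

locale positive_contraction =
  fixes Y :: "'a::complex_hilbert \<Rightarrow> 'a"
  assumes positive: "positive_op Y" and norm_le: "norm (Y x) \<le> norm x"
begin

lemma bounded_op: "bounded_op Y"
  using positive by (simp add: positive_op_def)

lemma funpow_norm_le: "norm ((Y ^^ n) x) \<le> norm x"
  by (induction n) (auto intro: order_trans[OF norm_le])

text \<open>The operator $1 - \sqrt{1-Y}$. The sum is taken pointwise, in the Hilbert space.\<close>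

definition root_series :: "'a \<Rightarrow> 'a" where
  "root_series x = (\<Sum>n. sqrt_coeff n *\<^sub>R (Y ^^ n) x)"

lemma root_series_term_norm_le: "norm (sqrt_coeff n *\<^sub>R (Y ^^ n) x) \<le> sqrt_coeff n * norm x"
  by (simp add: sqrt_coeff_nonneg mult_left_mono funpow_norm_le)

lemma root_series_abs_summable: "summable (\<lambda>n. norm (sqrt_coeff n *\<^sub>R (Y ^^ n) x))"
  by (rule summable_comparison_test'[OF summable_mult2[OF summable_sqrt_coeff, of "norm x"], of 0])
    (simp only: real_norm_def abs_norm_cancel root_series_term_norm_le)

lemma root_series_sums: "(\<lambda>n. sqrt_coeff n *\<^sub>R (Y ^^ n) x) sums root_series x"
  unfolding root_series_def by (rule summable_sums[OF summable_norm_cancel[OF root_series_abs_summable]])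

lemma norm_root_series_le: "norm (root_series x) \<le> norm x"
proof -
  have "norm (root_series x) \<le> (\<Sum>n. norm (sqrt_coeff n *\<^sub>R (Y ^^ n) x))"
    unfolding root_series_def by (rule summable_norm[OF root_series_abs_summable])
  also have "\<dots> \<le> (\<Sum>n. sqrt_coeff n * norm x)"
    by (rule suminf_le[OF root_series_term_norm_le root_series_abs_summable])
      (rule summable_mult2[OF summable_sqrt_coeff])
  also have "\<dots> = (\<Sum>n. sqrt_coeff n) * norm x"
    by (rule suminf_mult2[OF summable_sqrt_coeff, symmetric])
  also have "\<dots> \<le> 1 * norm x"
    by (intro mult_right_mono suminf_sqrt_coeff_le_1) simp
  finally show ?thesis by simp
qed

lemma root_series_commute:
  assumes C: "bounded_op C" and comm: "\<And>x. C (Y x) = Y (C x)"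
  shows "C (root_series x) = root_series (C x)"
proof -
  have pow: "C ((Y ^^ n) x) = (Y ^^ n) (C x)" for n
    by (induction n) (simp_all add: comm)
  have "(\<lambda>n. C (sqrt_coeff n *\<^sub>R (Y ^^ n) x)) sums C (root_series x)"
    using C by (intro bounded_linear.sums[OF _ root_series_sums]) (simp add: bounded_op_def)
  then have "(\<lambda>n. sqrt_coeff n *\<^sub>R (Y ^^ n) (C x)) sums C (root_series x)"
    by (simp add: bounded_op_scaleR[OF C] pow)
  then show ?thesis
    using root_series_sums sums_unique2 by blast
qed

lemma bounded_op_root_series: "bounded_op root_series"
  unfolding bounded_op_def
proof (intro conjI allI)
  show "bounded_linear root_series"
  proof (rule bounded_linear_intro[where K = 1])
    fix x y r
    have "(\<lambda>n. sqrt_coeff n *\<^sub>R (Y ^^ n) (x + y)) sums (root_series x + root_series y)"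
      using sums_add[OF root_series_sums[of x] root_series_sums[of y]]
      by (simp add: bounded_op_add[OF bounded_op_funpow[OF bounded_op]] scaleR_add_right)
    then show "root_series (x + y) = root_series x + root_series y"
      using root_series_sums sums_unique2 by blast
    have "(\<lambda>n. sqrt_coeff n *\<^sub>R (Y ^^ n) (r *\<^sub>R x)) sums (r *\<^sub>R root_series x)"
      using sums_scaleR_right[OF root_series_sums[of x], of r]
      by (simp add: bounded_op_scaleR[OF bounded_op_funpow[OF bounded_op]] mult.commute)
    then show "root_series (r *\<^sub>R x) = r *\<^sub>R root_series x"
      using root_series_sums sums_unique2 by blast
  qed (simp add: norm_root_series_le)
next
  fix c x
  have "(\<lambda>n. sqrt_coeff n *\<^sub>R (Y ^^ n) (c *\<^sub>C x)) sums (c *\<^sub>C root_series x)"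
    using bounded_linear.sums[OF bounded_linear_scaleC root_series_sums[of x], of c]
    by (simp add: bounded_op_scaleC[OF bounded_op_funpow[OF bounded_op]] scaleR_scaleC
        scaleC_scaleC mult.commute)
  then show "root_series (c *\<^sub>C x) = c *\<^sub>C root_series x"
    using root_series_sums sums_unique2 by blast
qed

lemma root_series_selfadjoint: "cinner (root_series x) y = cinner x (root_series y)"
proof -
  have pow: "cinner ((Y ^^ n) x) y = cinner x ((Y ^^ n) y)" for n x y
    by (induction n arbitrary: x y) (simp_all add: positive_op_selfadjoint[OF positive] funpow_swap1)
  have sums: "(\<lambda>n. of_real (sqrt_coeff n) * cinner ((Y ^^ n) u) v) sums cinner (root_series u) v" for u v
    using bounded_linear.sums[OF bounded_linear_cinner_left root_series_sums[of u], of v]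
    by (simp add: cinner_scaleR_left)
  have "(\<lambda>n. of_real (sqrt_coeff n) * cinner ((Y ^^ n) x) y) sums cnj (cinner (root_series y) x)"
    using sums_cnj[THEN iffD2, OF sums[of y x]]
    by (simp add: pow flip: cinner_commute)
  then show ?thesis
    using sums[of x y] sums_unique2 cinner_commute by metis
qed

text \<open>The square of the series is the double sum of $c_i c_j Y^{i+j} x$, which is dominated by
  $c_i c_j \|x\|$ and may be rearranged. Summed by rows it is the left-hand side; summed along the
  diagonals $i + j = k$ its coefficients are those of $2p - t$.\<close>

lemma root_series_square: "root_series (root_series x) = 2 *\<^sub>R root_series x - Y x"
proof -
  let ?c = sqrt_coeff
  define f where "f = (\<lambda>(i, j). (?c i * ?c j) *\<^sub>R (Y ^^ (i + j)) x)"
  have "(\<lambda>p. norm (f p)) summable_on UNIV"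
  proof (rule nonneg_bdd_above_summable_on)
    show "bdd_above (sum (\<lambda>p. norm (f p)) ` {F. F \<subseteq> UNIV \<and> finite F})"
    proof (rule bdd_aboveI2)
      fix F :: "(nat \<times> nat) set" assume "F \<in> {F. F \<subseteq> UNIV \<and> finite F}"
      then have "finite F" by simp
      then have "finite (fst ` F \<union> snd ` F)" by simp
      then obtain N where N: "fst ` F \<union> snd ` F \<subseteq> {..<N}"
        using finite_nat_iff_bounded by blast
      have "sum (\<lambda>p. norm (f p)) F \<le> (\<Sum>(i, j)\<in>{..<N} \<times> {..<N}. ?c i * ?c j * norm x)"
        using N \<open>finite F\<close>
        by (intro sum_le_included[where i = id])
          (auto simp: f_def sqrt_coeff_nonneg intro!: mult_left_mono funpow_norm_le bexI)
      also have "\<dots> = (\<Sum>i<N. \<Sum>j<N. ?c i * ?c j * norm x)"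
        by (rule sum.cartesian_product[symmetric])
      also have "\<dots> = (\<Sum>i<N. ?c i) * (\<Sum>i<N. ?c i) * norm x"
        by (subst sum_product) (simp only: sum_distrib_right)
      also have "\<dots> \<le> 1 * 1 * norm x"
        by (intro mult_mono sum_sqrt_coeff_le_1) (auto intro: sum_nonneg sqrt_coeff_nonneg mult_nonneg_nonneg)
      finally show "sum (\<lambda>p. norm (f p)) F \<le> norm x" by simp
    qed
  qed simp
  then have "f summable_on UNIV"
    by (rule abs_summable_summable)
  then obtain s where s: "(f has_sum s) (UNIV \<times> UNIV)"
    by (auto simp: summable_on_def)
  have row: "((\<lambda>j. f (i, j)) has_sum (?c i *\<^sub>R (Y ^^ i) (root_series x))) UNIV" for i
  proof -
    have "((\<lambda>j. ?c j *\<^sub>R (Y ^^ j) x) has_sum root_series x) UNIV"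
      by (rule norm_summable_imp_has_sum[OF root_series_abs_summable root_series_sums])
    moreover have "bounded_linear (\<lambda>z. ?c i *\<^sub>R (Y ^^ i) z)"
      using bounded_op_funpow[OF bounded_op, of i]
      by (intro bounded_linear_const_scaleR) (simp add: bounded_op_def)
    ultimately have "((\<lambda>j. ?c i *\<^sub>R (Y ^^ i) (?c j *\<^sub>R (Y ^^ j) x)) has_sum
        (?c i *\<^sub>R (Y ^^ i) (root_series x))) UNIV"
      using has_sum_bounded_linear[where h = "\<lambda>z. ?c i *\<^sub>R (Y ^^ i) z"] by (simp add: o_def)
    then show ?thesis
      by (simp add: f_def bounded_op_scaleR[OF bounded_op_funpow[OF bounded_op]] funpow_add)
  qed
  have "((\<lambda>i. ?c i *\<^sub>R (Y ^^ i) (root_series x)) has_sum s) UNIV"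
    by (rule has_sum_SigmaD[OF s row])
  then have rows: "s = root_series (root_series x)"
    using has_sum_imp_sums root_series_sums sums_unique2 by blast
  have "((\<lambda>(k, i). f (i, k - i)) has_sum s) (SIGMA k:UNIV. {..k})"
    using s by (subst has_sum_reindex_bij_witness[of _ "\<lambda>(i, j). (i + j, i)" "\<lambda>(k, i). (i, k - i)"]) auto
  then have "((\<lambda>k. \<Sum>i\<le>k. f (i, k - i)) has_sum s) UNIV"
    by (rule has_sum_SigmaD) (simp add: has_sum_finite)
  moreover have "(\<Sum>i\<le>k. f (i, k - i)) = 2 *\<^sub>R (?c k *\<^sub>R (Y ^^ k) x) - (if k = 1 then Y x else 0)" for k
  proof -
    have "(\<Sum>i\<le>k. f (i, k - i)) = (\<Sum>i\<le>k. (?c i * ?c (k - i)) *\<^sub>R (Y ^^ k) x)"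
      by (intro sum.cong) (auto simp: f_def)
    also have "\<dots> = (2 * ?c k - (if k = 1 then 1 else 0)) *\<^sub>R (Y ^^ k) x"
      by (simp add: sqrt_coeff_convolution flip: scaleR_left.sum)
    finally show ?thesis
      by (simp add: scaleR_diff_left)
  qed
  ultimately have "(\<lambda>k. 2 *\<^sub>R (?c k *\<^sub>R (Y ^^ k) x) - (if k = 1 then Y x else 0)) sums s"
    using has_sum_imp_sums by force
  moreover have "(\<lambda>k. 2 *\<^sub>R (?c k *\<^sub>R (Y ^^ k) x) - (if k = 1 then Y x else 0))
      sums (2 *\<^sub>R root_series x - Y x)"
    by (intro sums_diff sums_scaleR_right root_series_sums sums_single)
  ultimately show ?thesis
    using rows sums_unique2 by blast
qed

end

text \<open>After division by a bound $k$ of $A$, the operator $Y = 1 - A/k$ satisfies $0 \le Y \le 1$ as a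
  form, hence is a contraction by Cauchy-Schwarz, and $\sqrt{k}$ times $\sqrt{1-Y}$ is a root of $A$.
  The commutation property is recorded for the proof of uniqueness.\<close>

lemma positive_op_sqrt_exists:
  assumes A: "positive_op A"
  obtains B where "positive_op B" "B \<circ> B = A"
    "\<And>C x. bounded_op C \<Longrightarrow> (\<And>x. C (A x) = A (C x)) \<Longrightarrow> C (B x) = B (C x)"
proof -
  have bA: "bounded_op A"
    using A by (simp add: positive_op_def)
  obtain k where "k > 0" and k: "\<And>x. norm (A x) \<le> norm x * k"
    using bA bounded_linear.pos_bounded unfolding bounded_op_def by blast
  define Y where "Y x = x - A x /\<^sub>R k" for x
  have form: "cinner (Y x) x = of_real ((norm x)\<^sup>2 - Re (cinner (A x) x) / k)" for x
    using positive_op_cinner_self[OF A, of x]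
    by (simp add: Y_def cinner_diff_left cinner_scaleR_left cinner_self field_simps)
  have Re_A: "Re (cinner (A x) x) \<le> k * (norm x)\<^sup>2" for x
  proof -
    have "Re (cinner (A x) x) \<le> norm (A x) * norm x"
      using complex_Re_le_cmod cmod_cinner_le order_trans by blast
    also have "\<dots> \<le> (norm x * k) * norm x"
      by (intro mult_right_mono k) simp
    finally show ?thesis by (simp add: power2_eq_square mult_ac)
  qed
  have bY: "bounded_op Y"
    unfolding Y_def by (intro bounded_op_diff_op bounded_op_ident bounded_op_scaleR_op bA)
  have "positive_op Y"
    using Re_A \<open>k > 0\<close> by (simp add: positive_op_def bY form complex_nonneg_Reals_iff field_simps)
  moreover have "norm (Y x) \<le> norm x" for x
  proof -
    have form_le: "Re (cinner (Y z) z) \<le> (norm z)\<^sup>2" for z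
      using positive_op_Re_nonneg[OF A, of z] \<open>k > 0\<close> by (simp add: form)
    \<comment> \<open>Cauchy-Schwarz for the form of $Y$ at $x$ and $Yx$\<close>
    have "((norm (Y x))\<^sup>2)\<^sup>2 \<le> Re (cinner (Y x) x) * Re (cinner (Y (Y x)) (Y x))"
      using Cauchy_Schwarz_positive_op[OF \<open>positive_op Y\<close>, of x "Y x"]
      by (simp add: cinner_self del: of_real_power)
    also have "\<dots> \<le> (norm x)\<^sup>2 * (norm (Y x))\<^sup>2"
      by (intro mult_mono form_le positive_op_Re_nonneg[OF \<open>positive_op Y\<close>]) simp
    finally have "(norm (Y x))\<^sup>2 * (norm (Y x))\<^sup>2 \<le> (norm x)\<^sup>2 * (norm (Y x))\<^sup>2"
      by (simp only: power2_eq_square[of "(norm (Y x))\<^sup>2"])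
    then have "Y x \<noteq> 0 \<Longrightarrow> (norm (Y x))\<^sup>2 \<le> (norm x)\<^sup>2"
      by (rule mult_right_le_imp_le) simp
    then show ?thesis
      by (cases "Y x = 0") (auto intro: power2_le_imp_le)
  qed
  ultimately interpret positive_contraction Y
    by unfold_locales
  define B where "B x = sqrt k *\<^sub>R (x - root_series x)" for x
  have bB: "bounded_op B"
    unfolding B_def by (intro bounded_op_diff_op bounded_op_ident bounded_op_scaleR_op bounded_op_root_series)
  have "positive_op B"
    unfolding positive_op_def
  proof (intro conjI allI bB)
    fix x
    have "Im (cinner (root_series x) x) = 0"
      using arg_cong[OF cinner_commute[of "root_series x" x], of Im]
      by (simp add: root_series_selfadjoint)
    moreover have "Re (cinner (root_series x) x) \<le> (norm x)\<^sup>2"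
    proof -
      have "Re (cinner (root_series x) x) \<le> norm (root_series x) * norm x"
        using complex_Re_le_cmod cmod_cinner_le order_trans by blast
      also have "\<dots> \<le> norm x * norm x"
        by (intro mult_right_mono norm_root_series_le) simp
      finally show ?thesis by (simp add: power2_eq_square)
    qed
    ultimately show "cinner (B x) x \<in> \<real>\<^sub>\<ge>\<^sub>0"
      using \<open>k > 0\<close>
      by (simp add: B_def cinner_scaleR_left cinner_diff_left cinner_self complex_nonneg_Reals_iff
          del: of_real_power)
  qed
  moreover have "B \<circ> B = A"
  proof
    fix x
    have "(B \<circ> B) x = k *\<^sub>R (x - 2 *\<^sub>R root_series x + root_series (root_series x))"
      using \<open>k > 0\<close>
      by (simp add: B_def bounded_op_scaleR[OF bounded_op_root_series]
          bounded_op_diff[OF bounded_op_root_series] scaleR_diff_right[symmetric] scaleR_2)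
    also have "\<dots> = A x"
      using \<open>k > 0\<close> by (simp add: root_series_square Y_def)
    finally show "(B \<circ> B) x = A x" .
  qed
  moreover have "C (B x) = B (C x)" if C: "bounded_op C" and comm: "\<And>x. C (A x) = A (C x)" for C x
    by (simp add: B_def bounded_op_scaleR[OF C] bounded_op_diff[OF C]
        root_series_commute[OF C] Y_def comm)
  ultimately show ?thesis
    using that by blast
qed

lemma positive_op_form_zero:
  assumes "positive_op A" "Re (cinner (A x) x) = 0"
  shows "A x = 0"
  using Cauchy_Schwarz_positive_op[OF assms(1), of x "A x"] assms(2)
  by (simp add: cinner_self)

text \<open>Let $B$ be the root constructed above, $C$ another one. Since $C$ commutes with $A = C^2$, it
  commutes with $B$, so $(B+C)(B-C) = B^2 - C^2 = 0$. For $y = (B-C)x$ the two nonnegative numbers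
  $\langle By,y\rangle$ and $\langle Cy,y\rangle$ then add up to 0, so $By = Cy = 0$ and
  $\|y\|^2 = \langle x,(B-C)y\rangle = 0$.\<close>

lemma positive_op_ex1_sqrt:
  assumes "positive_op A"
  shows "\<exists>!B. positive_op B \<and> B \<circ> B = A"
proof -
  obtain B where B: "positive_op B" "B \<circ> B = A"
    and comm: "\<And>C x. bounded_op C \<Longrightarrow> (\<And>x. C (A x) = A (C x)) \<Longrightarrow> C (B x) = B (C x)"
    using positive_op_sqrt_exists[OF assms] by blast
  have "C = B" if C: "positive_op C" "C \<circ> C = A" for C
  proof
    fix x
    have bB: "bounded_op B" and bC: "bounded_op C"
      using B(1) C(1) by (auto simp: positive_op_def)
    have BB: "B (B x) = A x" and CC: "C (C x) = A x" for x
      using B(2) C(2) by (auto simp: fun_eq_iff)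
    have CB: "C (B x) = B (C x)" for x
      by (rule comm[OF bC]) (simp flip: CC)
    define y where "y = B x - C x"
    have "B y + C y = 0"
      by (simp add: y_def bounded_op_diff[OF bB] bounded_op_diff[OF bC] BB CC CB)
    then have "cinner (B y) y + cinner (C y) y = 0"
      by (simp add: cinner_zero_left flip: cinner_add_left)
    then have "Re (cinner (B y) y) + Re (cinner (C y) y) = 0"
      by (metis plus_complex.sel(1) zero_complex.sel(1))
    then have "Re (cinner (B y) y) = 0" "Re (cinner (C y) y) = 0"
      using positive_op_Re_nonneg[OF B(1), of y] positive_op_Re_nonneg[OF C(1), of y] by auto
    then have "B y = 0" "C y = 0"
      using positive_op_form_zero B(1) C(1) by blast+
    have "cinner y y = cinner (B x) y - cinner (C x) y"
      by (metis cinner_diff_left y_def)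
    also have "\<dots> = cinner x (B y) - cinner x (C y)"
      by (simp add: positive_op_selfadjoint[OF B(1)] positive_op_selfadjoint[OF C(1)])
    also have "\<dots> = 0"
      by (simp add: \<open>B y = 0\<close> \<open>C y = 0\<close>)
    finally show "C x = B x"
      by (simp add: cinner_self y_def)
  qed
  then show ?thesis
    using B by blast
qed

lemma
  assumes "positive_op A"
  shows positive_op_op_sqrt: "positive_op (op_sqrt A)"
    and op_sqrt_op_sqrt: "op_sqrt A (op_sqrt A x) = A x"
proof -
  have "positive_op (op_sqrt A) \<and> op_sqrt A \<circ> op_sqrt A = A"
    unfolding op_sqrt_def by (rule theI'[OF positive_op_ex1_sqrt[OF assms]])
  then show "positive_op (op_sqrt A)" "op_sqrt A (op_sqrt A x) = A x"
    by (auto simp: fun_eq_iff)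
qed


section \<open>The seminorm induced by a positive operator\<close>

locale semi_hilbert =
  fixes A :: "'a::complex_hilbert \<Rightarrow> 'a"
  assumes positive: "positive_op A" and nonzero: "A \<noteq> (\<lambda>x. 0)"
begin

lemma inner_wrt_eq: "inner_wrt A x y = cinner (op_sqrt A x) (op_sqrt A y)"
  unfolding inner_wrt_def
  by (metis op_sqrt_op_sqrt positive positive_op_op_sqrt positive_op_selfadjoint)

lemma norm_wrt_eq: "norm_wrt A x = norm (op_sqrt A x)"
  by (simp add: norm_wrt_def inner_wrt_eq cinner_norm)

lemma bounded_op_op_sqrt: "bounded_op (op_sqrt A)"
  using positive_op_op_sqrt[OF positive] by (simp add: positive_op_def)

lemma unit_vecs_nonempty: "unit_vecs A \<noteq> {}"
proof -
  obtain x where "A x \<noteq> 0"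
    using nonzero by auto
  then have "op_sqrt A x \<noteq> 0"
    using op_sqrt_op_sqrt[OF positive, of x] bounded_op_scaleR[OF bounded_op_op_sqrt, of 0 0] by auto
  then have "inverse (norm_wrt A x) *\<^sub>R x \<in> unit_vecs A"
    by (simp add: unit_vecs_def norm_wrt_eq bounded_op_scaleR[OF bounded_op_op_sqrt])
  then show ?thesis by blast
qed

definition bounded_wrt :: "('a \<Rightarrow> 'a) \<Rightarrow> bool" where
  "bounded_wrt T \<longleftrightarrow> (\<exists>K. \<forall>x\<in>unit_vecs A. norm_wrt A (T x) \<le> K)"

text \<open>With $z = A^{1/2}Tx$, the adjoint relation gives
  $\|z\|^2 = \langle A^{1/2}x, Rz\rangle \le \|R\| \|z\|$ for unit $x$; cancel $\|z\|$.\<close>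

lemma adjointable_imp_bounded_wrt:
  assumes "T \<in> adjointable_ops (op_sqrt A)"
  shows "bounded_wrt T"
proof -
  let ?B = "op_sqrt A"
  obtain R where R: "bounded_op R" and adj: "\<And>x y. cinner (?B (T x)) y = cinner (?B x) (R y)"
    using assms by (auto simp: adjointable_ops_def is_adjoint_wrt_def)
  obtain K where K: "\<And>x. norm (R x) \<le> norm x * K"
    using R bounded_linear.pos_bounded unfolding bounded_op_def by blast
  have "norm_wrt A (T x) \<le> K" if "x \<in> unit_vecs A" for x
  proof -
    define z where "z = ?B (T x)"
    have "(norm z)\<^sup>2 = cmod (cinner (?B x) (R z))"
      by (simp add: z_def cinner_self norm_power flip: adj)
    also have "\<dots> \<le> norm (?B x) * norm (R z)"
      by (rule cmod_cinner_le)
    also have "\<dots> \<le> 1 * (norm z * K)"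
      using that K[of z] by (simp add: unit_vecs_def norm_wrt_eq)
    finally have "norm z * norm z \<le> K * norm z"
      by (simp add: power2_eq_square mult.commute)
    moreover have "0 \<le> K"
    proof (rule ccontr)
      assume "\<not> 0 \<le> K"
      then have "norm (?B x) * K < 0"
        using that by (simp add: unit_vecs_def norm_wrt_eq)
      then show False
        using K[of "?B x"] norm_ge_zero[of "R (?B x)"] by linarith
    qed
    ultimately show ?thesis
      by (cases "z = 0") (simp_all add: norm_wrt_eq flip: z_def)
  qed
  then show ?thesis
    by (auto simp: bounded_wrt_def)
qed

lemma bounded_wrt_add_scaleC:
  assumes "bounded_wrt T" "bounded_wrt S"
  shows "bounded_wrt (\<lambda>x. T x + \<xi> *\<^sub>C S x)"
proof -
  obtain K M where K: "\<And>x. x \<in> unit_vecs A \<Longrightarrow> norm_wrt A (T x) \<le> K"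
    and M: "\<And>x. x \<in> unit_vecs A \<Longrightarrow> norm_wrt A (S x) \<le> M"
    using assms by (auto simp: bounded_wrt_def)
  have "norm_wrt A (T x + \<xi> *\<^sub>C S x) \<le> K + cmod \<xi> * M" if "x \<in> unit_vecs A" for x
  proof -
    have "norm_wrt A (T x + \<xi> *\<^sub>C S x) \<le> norm_wrt A (T x) + cmod \<xi> * norm_wrt A (S x)"
      using norm_triangle_ineq[of "op_sqrt A (T x)" "\<xi> *\<^sub>C op_sqrt A (S x)"]
      by (simp add: norm_wrt_eq norm_scaleC bounded_op_add[OF bounded_op_op_sqrt]
          bounded_op_scaleC[OF bounded_op_op_sqrt])
    also have "\<dots> \<le> K + cmod \<xi> * M"
      by (intro add_mono mult_left_mono K M that) simp
    finally show ?thesis .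
  qed
  then show ?thesis
    by (auto simp: bounded_wrt_def)
qed

end

section \<open>The weighted seminorm of an operator\<close>

locale weighted_semi_hilbert = semi_hilbert A for A :: "'a::complex_hilbert \<Rightarrow> 'a" +
  fixes l :: real
  assumes l_nonneg: "0 \<le> l" and l_le_1: "l \<le> 1"
begin

definition local_sq :: "('a \<Rightarrow> 'a) \<Rightarrow> 'a \<Rightarrow> real" where
  "local_sq T x = l * (norm_wrt A (T x))\<^sup>2 + (1 - l) * (cmod (inner_wrt A (T x) x))\<^sup>2"

text \<open>The semi-inner product of \<open>S\<close> and \<open>T\<close>, in this order, that polarizes \<open>local_sq\<close> at the fixed
  vector \<open>x\<close>.\<close>

definition cross_form :: "('a \<Rightarrow> 'a) \<Rightarrow> ('a \<Rightarrow> 'a) \<Rightarrow> 'a \<Rightarrow> complex" where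
  "cross_form T S x = of_real l * inner_wrt A (S x) (T x)
     + of_real (1 - l) * (inner_wrt A x (T x) * inner_wrt A (S x) x)"

lemma local_sq_nonneg: "0 \<le> local_sq T x"
  using l_nonneg l_le_1 by (simp add: local_sq_def)

lemma cmod_add_sq: "(cmod (a + b))\<^sup>2 = (cmod a)\<^sup>2 + 2 * Re (b * cnj a) + (cmod b)\<^sup>2"
  unfolding cmod_power2 by (simp add: power2_eq_square algebra_simps)

lemma local_sq_add_scaleC:
  "local_sq (\<lambda>x. T x + \<xi> *\<^sub>C S x) x
     = local_sq T x + 2 * Re (\<xi> * cross_form T S x) + (cmod \<xi>)\<^sup>2 * local_sq S x"
proof -
  let ?B = "op_sqrt A"
  have B_lin: "?B (T x + \<xi> *\<^sub>C S x) = ?B (T x) + \<xi> *\<^sub>C ?B (S x)"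
    by (simp add: bounded_op_add[OF bounded_op_op_sqrt] bounded_op_scaleC[OF bounded_op_op_sqrt])
  have norm_sq: "(norm z)\<^sup>2 = Re (cinner z z)" for z :: 'a
    by (simp add: cinner_self del: of_real_power)
  have "(norm_wrt A (T x + \<xi> *\<^sub>C S x))\<^sup>2
      = (norm_wrt A (T x))\<^sup>2 + 2 * Re (\<xi> * inner_wrt A (S x) (T x)) + (cmod \<xi> * norm_wrt A (S x))\<^sup>2"
  proof -
    have "cinner (?B (T x)) (\<xi> *\<^sub>C ?B (S x)) = cnj (\<xi> * cinner (?B (S x)) (?B (T x)))"
      by (metis cinner_commute cinner_scaleC_left)
    moreover have "(norm (\<xi> *\<^sub>C ?B (S x)))\<^sup>2 = (cmod \<xi> * norm (?B (S x)))\<^sup>2"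
      by (simp add: norm_scaleC)
    ultimately show ?thesis
      unfolding norm_wrt_eq inner_wrt_eq B_lin norm_sq[of "?B (T x) + \<xi> *\<^sub>C ?B (S x)"]
      by (simp add: cinner_add_left cinner_add_right norm_sq cinner_scaleC_left[of \<xi> _ "?B (T x)"])
  qed
  moreover have "(cmod (inner_wrt A (T x + \<xi> *\<^sub>C S x) x))\<^sup>2 = (cmod (inner_wrt A (T x) x))\<^sup>2
      + 2 * Re (\<xi> * (inner_wrt A x (T x) * inner_wrt A (S x) x)) + (cmod \<xi> * cmod (inner_wrt A (S x) x))\<^sup>2"
  proof -
    have "inner_wrt A (T x + \<xi> *\<^sub>C S x) x = inner_wrt A (T x) x + \<xi> * inner_wrt A (S x) x"
      unfolding inner_wrt_eq B_lin by (simp add: cinner_add_left cinner_scaleC_left)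
    moreover have "inner_wrt A x (T x) = cnj (inner_wrt A (T x) x)"
      unfolding inner_wrt_eq by (rule cinner_commute)
    ultimately show ?thesis
      by (simp add: cmod_add_sq norm_mult mult_ac)
  qed
  ultimately show ?thesis
    unfolding local_sq_def cross_form_def
    by (simp only:) (simp add: algebra_simps power_mult_distrib)
qed

lemma inner_wrt_le: "cmod (inner_wrt A x y) \<le> norm_wrt A x * norm_wrt A y"
  unfolding inner_wrt_eq norm_wrt_eq by (rule cmod_cinner_le)

lemma norm_wrt_nonneg: "0 \<le> norm_wrt A x"
  by (simp add: norm_wrt_eq)

lemma cross_form_le:
  assumes "x \<in> unit_vecs A"
  shows "cmod (cross_form T S x) \<le> norm_wrt A (T x) * norm_wrt A (S x)"
proof -
  have x: "norm_wrt A x = 1"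
    using assms by (simp add: unit_vecs_def)
  have "cmod (cross_form T S x) \<le> l * cmod (inner_wrt A (S x) (T x))
      + (1 - l) * (cmod (inner_wrt A x (T x)) * cmod (inner_wrt A (S x) x))"
    unfolding cross_form_def using l_nonneg l_le_1
    by (intro order_trans[OF norm_triangle_ineq]) (simp add: norm_mult del: of_real_diff)
  also have "\<dots> \<le> l * (norm_wrt A (T x) * norm_wrt A (S x))
      + (1 - l) * (norm_wrt A (T x) * norm_wrt A (S x))"
    using l_nonneg l_le_1 inner_wrt_le[of "S x" "T x"] inner_wrt_le[of x "T x"] inner_wrt_le[of "S x" x]
    by (intro add_mono mult_left_mono mult_mono) (simp_all add: x mult.commute norm_wrt_nonneg)
  finally show ?thesis
    by (simp add: algebra_simps)
qed

lemma local_sq_le: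
  assumes "x \<in> unit_vecs A"
  shows "local_sq T x \<le> (norm_wrt A (T x))\<^sup>2"
proof -
  have "cmod (inner_wrt A (T x) x) \<le> norm_wrt A (T x)"
    using inner_wrt_le[of "T x" x] assms by (simp add: unit_vecs_def)
  then have "local_sq T x \<le> l * (norm_wrt A (T x))\<^sup>2 + (1 - l) * (norm_wrt A (T x))\<^sup>2"
    unfolding local_sq_def using l_le_1 by (intro add_left_mono mult_left_mono power_mono) auto
  then show ?thesis
    by (simp add: algebra_simps)
qed

lemma op_norm_eq: "op_norm A l T = (SUP x\<in>unit_vecs A. sqrt (local_sq T x))"
  by (simp add: op_norm_def local_sq_def)

lemma op_minmod_eq: "op_minmod A l T = (INF x\<in>unit_vecs A. sqrt (local_sq T x))"
  by (simp add: op_minmod_def local_sq_def)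

lemma bdd_above_sqrt_local_sq:
  assumes "bounded_wrt T"
  shows "bdd_above ((\<lambda>x. sqrt (local_sq T x)) ` unit_vecs A)"
proof -
  obtain K where K: "\<And>x. x \<in> unit_vecs A \<Longrightarrow> norm_wrt A (T x) \<le> K"
    using assms by (auto simp: bounded_wrt_def)
  have "sqrt (local_sq T x) \<le> K" if "x \<in> unit_vecs A" for x
    using real_sqrt_le_mono[OF local_sq_le[OF that, of T]] K[OF that] norm_wrt_nonneg[of "T x"] by simp
  then show ?thesis
    by (rule bdd_aboveI2)
qed

lemma op_norm_nonneg:
  assumes "bounded_wrt T"
  shows "0 \<le> op_norm A l T"
proof -
  obtain x where "x \<in> unit_vecs A"
    using unit_vecs_nonempty by blast
  then show ?thesis
    unfolding op_norm_eq using cSUP_upper2[OF bdd_above_sqrt_local_sq[OF assms]] local_sq_nonneg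
    by (meson real_sqrt_ge_zero)
qed

lemma local_sq_le_op_norm:
  assumes "bounded_wrt T" "x \<in> unit_vecs A"
  shows "local_sq T x \<le> (op_norm A l T)\<^sup>2"
  unfolding op_norm_eq using cSUP_upper[OF assms(2) bdd_above_sqrt_local_sq[OF assms(1)]]
  by (rule sqrt_le_D)

text \<open>Together with \<open>local_sq_le_op_norm\<close> this says that the squared norm is the supremum of the
  squares, which spares the later limits the square roots.\<close>

lemma op_norm_approx:
  assumes "bounded_wrt T" "c < (op_norm A l T)\<^sup>2"
  obtains x where "x \<in> unit_vecs A" "c < local_sq T x"
proof (cases "c < 0")
  case True
  then show ?thesis
    using unit_vecs_nonempty local_sq_nonneg that by (meson all_not_in_conv less_le_trans)
next
  case False
  then have "sqrt c < op_norm A l T"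
    using assms op_norm_nonneg[OF assms(1)] by (simp add: real_less_lsqrt)
  then obtain x where "x \<in> unit_vecs A" "sqrt c < sqrt (local_sq T x)"
    unfolding op_norm_eq
    using less_cSUP_iff[OF unit_vecs_nonempty bdd_above_sqrt_local_sq[OF assms(1)]] by blast
  then show ?thesis
    using that by simp
qed

lemma op_minmod_sq_le:
  assumes "x \<in> unit_vecs A"
  shows "(op_minmod A l S)\<^sup>2 \<le> local_sq S x"
proof -
  have "op_minmod A l S \<le> sqrt (local_sq S x)"
    unfolding op_minmod_eq by (intro cINF_lower assms bdd_belowI2[where m = 0]) (simp add: local_sq_nonneg)
  moreover have "0 \<le> op_minmod A l S"
    unfolding op_minmod_eq by (intro cINF_greatest unit_vecs_nonempty) (simp add: local_sq_nonneg)
  ultimately have "(op_minmod A l S)\<^sup>2 \<le> (sqrt (local_sq S x))\<^sup>2"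
    by (rule power_mono)
  then show ?thesis
    by (simp add: local_sq_nonneg)
qed

section \<open>Orthogonality and norming sequences\<close>

text \<open>For each angle separately, the existence of such a sequence is what (i) asks for.\<close>

definition norming_seq :: "('a \<Rightarrow> 'a) \<Rightarrow> ('a \<Rightarrow> 'a) \<Rightarrow> real \<Rightarrow> (nat \<Rightarrow> 'a) \<Rightarrow> bool" where
  "norming_seq T S \<theta> x \<longleftrightarrow> (\<forall>n. x n \<in> unit_vecs A) \<and>
     (\<lambda>n. local_sq T (x n)) \<longlonglongrightarrow> (op_norm A l T)\<^sup>2 \<and>
     (\<exists>L\<ge>0. (\<lambda>n. Re (exp (\<i> * of_real \<theta>) * cross_form T S (x n))) \<longlonglongrightarrow> L)"

text \<open>Along the sequence the quadratic identity for $\xi = |\xi| e^{i\theta}$ has a limit in which the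
  cross term is nonnegative.\<close>

lemma norming_seq_imp_ge:
  assumes T: "bounded_wrt T" and S: "bounded_wrt S"
    and x: "norming_seq T S (Arg2pi \<xi>) x"
  shows "(op_norm A l T)\<^sup>2 + (cmod \<xi>)\<^sup>2 * (op_minmod A l S)\<^sup>2
    \<le> (op_norm A l (\<lambda>x. T x + \<xi> *\<^sub>C S x))\<^sup>2"
proof -
  let ?h = "\<lambda>n. Re (exp (\<i> * of_real (Arg2pi \<xi>)) * cross_form T S (x n))"
  obtain L where x_unit: "\<And>n. x n \<in> unit_vecs A" and "L \<ge> 0" and h: "?h \<longlonglongrightarrow> L"
    and norming: "(\<lambda>n. local_sq T (x n)) \<longlonglongrightarrow> (op_norm A l T)\<^sup>2"
    using x by (auto simp: norming_seq_def)
  have le: "local_sq T (x n) + 2 * cmod \<xi> * ?h n + (cmod \<xi>)\<^sup>2 * (op_minmod A l S)\<^sup>2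
      \<le> (op_norm A l (\<lambda>x. T x + \<xi> *\<^sub>C S x))\<^sup>2" for n
  proof -
    have "\<xi> * cross_form T S (x n)
        = of_real (cmod \<xi>) * (exp (\<i> * of_real (Arg2pi \<xi>)) * cross_form T S (x n))"
      by (metis Arg2pi_eq mult.assoc)
    then have "Re (\<xi> * cross_form T S (x n)) = cmod \<xi> * ?h n"
      by (metis Re_complex_of_real Im_complex_of_real times_complex.sel(1) diff_zero mult_zero_left)
    then have "local_sq T (x n) + 2 * cmod \<xi> * ?h n + (cmod \<xi>)\<^sup>2 * (op_minmod A l S)\<^sup>2
      \<le> local_sq (\<lambda>x. T x + \<xi> *\<^sub>C S x) (x n)"
      unfolding local_sq_add_scaleC using op_minmod_sq_le[OF x_unit, of S n]
      by (simp add: mult_left_mono)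
    also have "\<dots> \<le> (op_norm A l (\<lambda>x. T x + \<xi> *\<^sub>C S x))\<^sup>2"
      by (intro local_sq_le_op_norm bounded_wrt_add_scaleC T S x_unit)
    finally show ?thesis .
  qed
  have lim: "(\<lambda>n. local_sq T (x n) + 2 * cmod \<xi> * ?h n + (cmod \<xi>)\<^sup>2 * (op_minmod A l S)\<^sup>2)
      \<longlonglongrightarrow> (op_norm A l T)\<^sup>2 + 2 * cmod \<xi> * L + (cmod \<xi>)\<^sup>2 * (op_minmod A l S)\<^sup>2"
    by (intro tendsto_intros norming h)
  have "(op_norm A l T)\<^sup>2 + 2 * cmod \<xi> * L + (cmod \<xi>)\<^sup>2 * (op_minmod A l S)\<^sup>2
      \<le> (op_norm A l (\<lambda>x. T x + \<xi> *\<^sub>C S x))\<^sup>2"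
    by (rule LIMSEQ_le_const2[OF lim]) (use le in blast)
  moreover have "0 \<le> 2 * cmod \<xi> * L"
    using \<open>L \<ge> 0\<close> by simp
  ultimately show ?thesis
    by linarith
qed

text \<open>Take near-maximizers for $T + r e^{i\theta} S$ with $r \to 0$. Their error $r^2$ is of smaller
  order than the cross term, which is multiplied by $r$, so it survives division by $r$.\<close>

lemma orthogonal_imp_norming_seq:
  assumes T: "bounded_wrt T" and S: "bounded_wrt S" and orth: "op_orthogonal A l T S"
  shows "\<exists>x. norming_seq T S \<theta> x"
proof -
  define e where "e = exp (\<i> * complex_of_real \<theta>)"
  define r where "r n = inverse (real (Suc n))" for n
  define N where "N = op_norm A l T"
  have r_pos: "r n > 0" for n
    by (simp add: r_def)
  have cmod_e: "cmod e = 1"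
    by (simp add: e_def)
  have "\<exists>x. x \<in> unit_vecs A \<and> N\<^sup>2 - (r n)\<^sup>2 < local_sq (\<lambda>x. T x + (of_real (r n) * e) *\<^sub>C S x) x" for n
  proof -
    have "N\<^sup>2 \<le> (op_norm A l (\<lambda>x. T x + (of_real (r n) * e) *\<^sub>C S x))\<^sup>2"
      using orth op_norm_nonneg[OF T] unfolding N_def op_orthogonal_def by (blast intro: power_mono)
    then have "N\<^sup>2 - (r n)\<^sup>2 < (op_norm A l (\<lambda>x. T x + (of_real (r n) * e) *\<^sub>C S x))\<^sup>2"
      using r_pos[of n] by (smt (verit) zero_less_power)
    then show ?thesis
      using op_norm_approx[OF bounded_wrt_add_scaleC[OF T S]] by metis
  qed
  then obtain x where x_unit: "\<And>n. x n \<in> unit_vecs A"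
    and x: "\<And>n. N\<^sup>2 - (r n)\<^sup>2 < local_sq (\<lambda>x. T x + (of_real (r n) * e) *\<^sub>C S x) (x n)"
    by metis
  define h where "h n = Re (e * cross_form T S (x n))" for n
  define M where "M = (op_norm A l S)\<^sup>2"
  have Re_scale: "Re (of_real (r n) * e * cross_form T S (x n)) = r n * h n" for n
    by (simp add: h_def algebra_simps)
  \<comment> \<open>the choice of \<open>x\<close> rewritten by the quadratic identity, with both terms of order \<open>r\<^sup>2\<close> collected\<close>
  have near: "N\<^sup>2 < local_sq T (x n) + 2 * r n * h n + (r n)\<^sup>2 * (1 + M)" for n
  proof -
    have "(r n)\<^sup>2 * local_sq S (x n) \<le> (r n)\<^sup>2 * M"
      unfolding M_def by (intro mult_left_mono local_sq_le_op_norm S x_unit) simp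
    moreover have "local_sq (\<lambda>x. T x + (of_real (r n) * e) *\<^sub>C S x) (x n)
        = local_sq T (x n) + 2 * (r n * h n) + (r n)\<^sup>2 * local_sq S (x n)"
      unfolding local_sq_add_scaleC Re_scale by (simp add: norm_mult cmod_e)
    ultimately show ?thesis
      using x[of n] by (simp add: distrib_left)
  qed
  have upper: "local_sq T (x n) \<le> N\<^sup>2" for n
    unfolding N_def by (rule local_sq_le_op_norm[OF T x_unit])
  obtain K where K: "\<And>n. \<bar>h n\<bar> \<le> K"
  proof -
    obtain C D where C: "\<And>x. x \<in> unit_vecs A \<Longrightarrow> norm_wrt A (T x) \<le> C"
      and D: "\<And>x. x \<in> unit_vecs A \<Longrightarrow> norm_wrt A (S x) \<le> D"
      using T S by (auto simp: bounded_wrt_def)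
    have "\<bar>h n\<bar> \<le> C * D" for n
    proof -
      have "\<bar>h n\<bar> \<le> cmod (e * cross_form T S (x n))"
        unfolding h_def by (rule abs_Re_le_cmod)
      also have "\<dots> \<le> norm_wrt A (T (x n)) * norm_wrt A (S (x n))"
        using cross_form_le[OF x_unit] by (simp add: norm_mult cmod_e)
      also have "\<dots> \<le> C * D"
        using C[OF x_unit] norm_wrt_nonneg order_trans
        by (intro mult_mono D x_unit) blast+
      finally show ?thesis .
    qed
    then show ?thesis
      using that by blast
  qed
  have r_lim: "r \<longlonglongrightarrow> 0"
    unfolding r_def by (rule LIMSEQ_inverse_real_of_nat)
  have norming: "(\<lambda>n. local_sq T (x n)) \<longlonglongrightarrow> N\<^sup>2"
  proof (rule tendsto_sandwich)
    show "(\<lambda>n. N\<^sup>2 - 2 * r n * K - (r n)\<^sup>2 * (1 + M)) \<longlonglongrightarrow> N\<^sup>2"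
    proof -
      have "(\<lambda>n. N\<^sup>2 - 2 * r n * K - (r n)\<^sup>2 * (1 + M)) \<longlonglongrightarrow> N\<^sup>2 - 2 * 0 * K - 0\<^sup>2 * (1 + M)"
        by (intro tendsto_intros r_lim)
      then show ?thesis by simp
    qed
    show "\<forall>\<^sub>F n in sequentially. N\<^sup>2 - 2 * r n * K - (r n)\<^sup>2 * (1 + M) \<le> local_sq T (x n)"
    proof (intro always_eventually allI)
      fix n
      have "r n * h n \<le> r n * K"
        using K[of n] r_pos[of n] by (intro mult_left_mono) auto
      then show "N\<^sup>2 - 2 * r n * K - (r n)\<^sup>2 * (1 + M) \<le> local_sq T (x n)"
        using near[of n] by linarith
    qed
    show "\<forall>\<^sub>F n in sequentially. local_sq T (x n) \<le> N\<^sup>2"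
      using upper by simp
  qed simp
  have h_lower: "- r n * (1 + M) / 2 \<le> h n" for n
  proof -
    have "0 \<le> r n * (2 * h n + r n * (1 + M))"
      using near[of n] upper[of n] by (simp add: algebra_simps power2_eq_square)
    then have "0 \<le> 2 * h n + r n * (1 + M)"
      using r_pos[of n] by (simp add: zero_le_mult_iff)
    then show ?thesis by linarith
  qed
  have "bounded (range h)"
    using K by (auto simp: bounded_iff)
  then obtain L s where s: "strict_mono s" and L: "(h \<circ> s) \<longlonglongrightarrow> L"
    using bounded_imp_convergent_subsequence by blast
  have "(\<lambda>n. - r (s n) * (1 + M) / 2) \<longlonglongrightarrow> - 0 * (1 + M) / 2"
    using LIMSEQ_subseq_LIMSEQ[OF r_lim s] unfolding o_def by (intro tendsto_intros) simp_all
  from LIMSEQ_le[OF this L] have "0 \<le> L"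
    using h_lower by auto
  moreover have "(\<lambda>n. local_sq T (x (s n))) \<longlonglongrightarrow> N\<^sup>2"
    using LIMSEQ_subseq_LIMSEQ[OF norming s] by (simp add: o_def)
  ultimately have "norming_seq T S \<theta> (x \<circ> s)"
    using x_unit L unfolding norming_seq_def by (auto simp: N_def h_def e_def o_def)
  then show ?thesis by blast
qed

end

theorem theorem2p7:
  fixes A T S :: "'a::complex_hilbert \<Rightarrow> 'a" and l :: real
  assumes "positive_op A" and "A \<noteq> (\<lambda>x. 0)"
    and "0 \<le> l" and "l \<le> 1"
    and "T \<in> adjointable_ops (op_sqrt A)"
    and "S \<in> adjointable_ops (op_sqrt A)"
  defines "stmt_i \<equiv> (\<forall>\<theta>\<in>{0..<2 * pi}. \<exists>x :: nat \<Rightarrow> 'a.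
      (\<forall>n. x n \<in> unit_vecs A) \<and>
      (\<lambda>n. l * (norm_wrt A (T (x n)))\<^sup>2 + (1 - l) * (cmod (inner_wrt A (T (x n)) (x n)))\<^sup>2)
        \<longlonglongrightarrow> (op_norm A l T)\<^sup>2 \<and>
      (\<exists>L\<ge>0. (\<lambda>n. Re (exp (\<i> * complex_of_real \<theta>) * complex_of_real l *
                         inner_wrt A (S (x n)) (T (x n))
                     + exp (\<i> * complex_of_real \<theta>) * complex_of_real (1 - l) *
                         inner_wrt A (x n) (T (x n)) * inner_wrt A (S (x n)) (x n)))
        \<longlonglongrightarrow> L))"
    and "stmt_ii \<equiv> (\<forall>\<xi>. (op_norm A l (\<lambda>x. T x + \<xi> *\<^sub>C S x))\<^sup>2
                      \<ge> (op_norm A l T)\<^sup>2 + (cmod \<xi>)\<^sup>2 * (op_minmod A l S)\<^sup>2)"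
    and "stmt_iii \<equiv> op_orthogonal A l T S"
  shows "(stmt_i \<longleftrightarrow> stmt_ii) \<and> (stmt_ii \<longleftrightarrow> stmt_iii)"
proof -
  interpret weighted_semi_hilbert A l
    using assms(1-4) by unfold_locales
  have T: "bounded_wrt T" and S: "bounded_wrt S"
    using assms(5,6) by (auto intro: adjointable_imp_bounded_wrt)
  have stmt_i: "stmt_i \<longleftrightarrow> (\<forall>\<theta>\<in>{0..<2 * pi}. \<exists>x. norming_seq T S \<theta> x)"
    unfolding stmt_i_def norming_seq_def local_sq_def cross_form_def
    by (simp only: distrib_left mult.assoc)
  have stmt_ii if stmt_i
    unfolding stmt_ii_def
  proof
    fix \<xi>
    have "Arg2pi \<xi> \<in> {0..<2 * pi}"
      by (simp add: Arg2pi_ge_0 Arg2pi_lt_2pi)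
    then obtain x where "norming_seq T S (Arg2pi \<xi>) x"
      using \<open>stmt_i\<close> unfolding stmt_i by blast
    then show "(op_norm A l T)\<^sup>2 + (cmod \<xi>)\<^sup>2 * (op_minmod A l S)\<^sup>2
        \<le> (op_norm A l (\<lambda>x. T x + \<xi> *\<^sub>C S x))\<^sup>2"
      by (rule norming_seq_imp_ge[OF T S])
  qed
  moreover have "stmt_iii" if stmt_ii
    unfolding stmt_iii_def op_orthogonal_def
  proof
    fix \<xi>
    have "(op_norm A l T)\<^sup>2 \<le> (op_norm A l T)\<^sup>2 + (cmod \<xi>)\<^sup>2 * (op_minmod A l S)\<^sup>2"
      by simp
    also have "\<dots> \<le> (op_norm A l (\<lambda>x. T x + \<xi> *\<^sub>C S x))\<^sup>2"
      using that unfolding stmt_ii_def by blast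
    finally show "op_norm A l T \<le> op_norm A l (\<lambda>x. T x + \<xi> *\<^sub>C S x)"
      using op_norm_nonneg[OF bounded_wrt_add_scaleC[OF T S]] by (rule power2_le_imp_le)
  qed
  moreover have "stmt_iii \<Longrightarrow> stmt_i"
    unfolding stmt_i stmt_iii_def using orthogonal_imp_norming_seq[OF T S] by blast
  ultimately show ?thesis by blast
qed

end
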